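(* Let $d\ge1$, $\boldsymbol n=(n_1,\dots,n_d)\in\mathbb N_0^d$, $n=\sum_i n_i$, $s>0$, and let $\mathcal H(\boldsymbol\pi)=-\sum_{i=1}^d\pi_i\log\pi_i$ be the entropy of a probability vector $\boldsymbol\pi$. Let the uncertainty of $\boldsymbol\pi$ be modeled by the Imprecise Dirichlet Model. For $\boldsymbol t\in\Delta$ let $u_i=\frac{n_i+st_i}{n+s}$. Then the expected entropy $H(\boldsymbol u):=E_{\boldsymbol t}[\mathcal H]$ for given hyperparameter $\boldsymbol t$ and sample $\boldsymbol n$ is $$H(\boldsymbol u)=\sum_{i=1}^d h(u_i),\qquad h(u)=u\cdot\bigl[\psi(n+s+1)-\psi((n+s)u+1)\bigr],$$ and, whenever $s$ and $(n+s)u$ are integers, $h(u)=u\cdot\sum_{k=(n+s)u+1}^{n+s}k^{-1}$. Moreover, the lower expected entropy $\underline H=\min_{\boldsymbol t\in\Delta}H(\boldsymbol u)$ is attained at $\boldsymbol u=\boldsymbol u^{\underline H}$ with $$u_i^{\underline H}=\frac{n_i+s\,\delta_{i\,i^{\underline H}}}{n+s},\qquad i^{\underline H}:=\arg\max_i n_i,$$ and the upper expected entropy $\overline H=\max_{\boldsymbol t\in\Delta}H(\boldsymbol u)$ is attained at $\boldsymbol u=\boldsymbol u^{\overline H}$ with $$u_i^{\overline H}=\max\Bigl\{\frac{n_i}{n+s},\tilde u\Bigr\},\qquad \tilde u:=\min_{m\in\{1,\dots,d\}}\frac{s+\sum_{k\le m}n_{i_k}}{m(n+s)},$$ where $i_1,\dots,i_d$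 is an ordering of $\{1,\dots,d\}$ with $n_{i_1}\le\dots\le n_{i_d}$.
   Context: $\Delta:=\{\boldsymbol t\in\mathbb R^d: t_i\ge0\ \forall i,\ \sum_i t_i=1\}$. The Imprecise Dirichlet Model (IDM) with fixed $s>0$ considers, for an i.i.d. process with unknown chances $\boldsymbol\pi$ in the probability simplex, the set of all Dirichlet priors $p(\boldsymbol\pi)\propto\prod_i\pi_i^{st_i-1}$, $\boldsymbol t\in\Delta$. Given counts $\boldsymbol n$ ($n_i$ is the number of observations of outcome $i$), each $\boldsymbol t$ gives the Dirichlet posterior $p(\boldsymbol\pi|\boldsymbol n)\propto\prod_i\pi_i^{n_i+st_i-1}$ on the probability simplex, and $E_{\boldsymbol t}$ denotes expectation with respect to this posterior. Where the posterior is improper (boundary values of $\boldsymbol t$), functions of $\boldsymbol t$ are understood as continuously extended to the boundary of $\Delta$. $\psi(x)=\frac{d}{dx}\log\Gamma(x)$ is the digamma function, $\log$ is the natural logarithm, $\delta_{ij}$ is Kronecker's delta, and ties in $\arg\max$ are broken arbitrarily. *)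

theory Defs
  imports "HOL-Probability.Probability"
begin

definition prob_simplex :: "nat \<Rightarrow> (nat \<Rightarrow> real) set" where
  "prob_simplex d = {x \<in> {1..d} \<rightarrow>\<^sub>E {0..}. (\<Sum>i=1..d. x i) = 1}"

text \<open>
  Lebesgue measure on the hyperplane where the \<open>d\<close> coordinates sum to \<open>1\<close>, parametrised by the
  first \<open>d - 1\<close> coordinates. For \<open>d = 1\<close> this is the point mass at the only point of the simplex.
\<close>

definition hyperplane_lebesgue :: "nat \<Rightarrow> (nat \<Rightarrow> real) measure" where
  "hyperplane_lebesgue d =
     distr (PiM {1..<d} (\<lambda>_. lborel)) (PiM {1..d} (\<lambda>_. borel))
       (\<lambda>y. y(d := 1 - (\<Sum>i=1..<d. y i)))"

definition dirichlet_weight :: "nat \<Rightarrow> (nat \<Rightarrow> real) \<Rightarrow> (nat \<Rightarrow> real) \<Rightarrow> real" where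
  "dirichlet_weight d a p = indicator (prob_simplex d) p * (\<Prod>i=1..d. p i powr (a i - 1))"

definition dirichlet_mass :: "nat \<Rightarrow> (nat \<Rightarrow> real) \<Rightarrow> ennreal" where
  "dirichlet_mass d a = (\<integral>\<^sup>+p. ennreal (dirichlet_weight d a p) \<partial>hyperplane_lebesgue d)"

definition dirichlet :: "nat \<Rightarrow> (nat \<Rightarrow> real) \<Rightarrow> (nat \<Rightarrow> real) measure" where
  "dirichlet d a =
     density (hyperplane_lebesgue d) (\<lambda>p. ennreal (dirichlet_weight d a p) / dirichlet_mass d a)"

definition dirichlet_proper :: "nat \<Rightarrow> (nat \<Rightarrow> real) \<Rightarrow> bool" where
  "dirichlet_proper d a \<longleftrightarrow> dirichlet_mass d a < \<infinity>"

definition posterior_param :: "(nat \<Rightarrow> nat) \<Rightarrow> real \<Rightarrow> (nat \<Rightarrow> real) \<Rightarrow> nat \<Rightarrow> real" where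
  "posterior_param n s t i = real (n i) + s * t i"

definition idm_posterior ::
    "nat \<Rightarrow> (nat \<Rightarrow> nat) \<Rightarrow> real \<Rightarrow> (nat \<Rightarrow> real) \<Rightarrow> (nat \<Rightarrow> real) measure" where
  "idm_posterior d n s t = dirichlet d (posterior_param n s t)"

definition idm_proper :: "nat \<Rightarrow> (nat \<Rightarrow> nat) \<Rightarrow> real \<Rightarrow> (nat \<Rightarrow> real) set" where
  "idm_proper d n s = {t \<in> prob_simplex d. dirichlet_proper d (posterior_param n s t)}"

text \<open>
  Posterior expectation as a function of \<open>t\<close> on the simplex. At those boundary points where the
  posterior is improper it is the limit along the points with proper posterior; the limit is taken
  in the product topology, which on the simplex is the Euclidean one because all points of the
  simplex agree outside \<open>{1..d}\<close>.
\<close>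

definition idm_expectation ::
    "nat \<Rightarrow> (nat \<Rightarrow> nat) \<Rightarrow> real \<Rightarrow> ((nat \<Rightarrow> real) \<Rightarrow> real) \<Rightarrow> (nat \<Rightarrow> real) \<Rightarrow> real" where
  "idm_expectation d n s F t =
     (if t \<in> idm_proper d n s then \<integral>p. F p \<partial>idm_posterior d n s t
      else Lim (at t within idm_proper d n s) (\<lambda>t'. \<integral>p. F p \<partial>idm_posterior d n s t'))"

text \<open>The convention \<open>0 log 0 = 0\<close> is automatic.\<close>

definition vec_entropy :: "nat \<Rightarrow> (nat \<Rightarrow> real) \<Rightarrow> real" where
  "vec_entropy d p = - (\<Sum>i=1..d. p i * ln (p i))"

abbreviation expected_entropy ::
    "nat \<Rightarrow> (nat \<Rightarrow> nat) \<Rightarrow> real \<Rightarrow> (nat \<Rightarrow> real) \<Rightarrow> real" where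
  "expected_entropy d n s \<equiv> idm_expectation d n s (vec_entropy d)"

definition sample_size :: "nat \<Rightarrow> (nat \<Rightarrow> nat) \<Rightarrow> nat" where
  "sample_size d n = (\<Sum>i=1..d. n i)"

definition idm_u :: "nat \<Rightarrow> (nat \<Rightarrow> nat) \<Rightarrow> real \<Rightarrow> (nat \<Rightarrow> real) \<Rightarrow> nat \<Rightarrow> real" where
  "idm_u d n s t i = (real (n i) + s * t i) / (real (sample_size d n) + s)"

definition entropy_term :: "nat \<Rightarrow> real \<Rightarrow> real \<Rightarrow> real" where
  "entropy_term N s u = u * (Digamma (real N + s + 1) - Digamma ((real N + s) * u + 1))"

definition u_lower :: "nat \<Rightarrow> (nat \<Rightarrow> nat) \<Rightarrow> real \<Rightarrow> nat \<Rightarrow> nat \<Rightarrow> real" where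
  "u_lower d n s j i = (real (n i) + s * (if i = j then 1 else 0)) / (real (sample_size d n) + s)"

definition u_tilde :: "nat \<Rightarrow> (nat \<Rightarrow> nat) \<Rightarrow> real \<Rightarrow> (nat \<Rightarrow> nat) \<Rightarrow> real" where
  "u_tilde d n s \<sigma> =
     Min ((\<lambda>m. (s + (\<Sum>k=1..m. real (n (\<sigma> k)))) / (real m * (real (sample_size d n) + s))) ` {1..d})"

definition u_upper :: "nat \<Rightarrow> (nat \<Rightarrow> nat) \<Rightarrow> real \<Rightarrow> (nat \<Rightarrow> nat) \<Rightarrow> nat \<Rightarrow> real" where
  "u_upper d n s \<sigma> i = max (real (n i) / (real (sample_size d n) + s)) (u_tilde d n s \<sigma>)"

end

theory Submission
  imports Defs
begin

text \<open>
  Integrating out one coordinate at a time with the Beta integral gives the normalising constant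
  \<open>(\<Prod>i. \<Gamma>(a i)) / \<Gamma>(\<Sum>i. a i)\<close> of the Dirichlet weight, hence the moments \<open>E[p i powr x]\<close> as quotients of
  Gamma values. Differentiating the moments at \<open>x = 1\<close> (by dominated convergence, since
  \<open>(p powr (1 + e) - p) / e\<close> is bounded by \<open>1\<close> on the unit interval) yields \<open>E[p i * ln (p i)]\<close> in terms of
  the digamma function. The posterior is improper exactly if some parameter vanishes, and there
  the formula extends by continuity.

  With \<open>x i = n i + s * t i\<close>, the expected entropy is a constant minus a positive multiple of
  \<open>\<Sum>i. g (x i)\<close>, where \<open>g x = x * \<psi>(x + 1)\<close>. The function \<open>g\<close> is convex, being a pointwise limit of sums
  of affine functions and terms \<open>k / (k + x)\<close>. By convexity \<open>\<Sum>i. g (x i)\<close> is largest if all of the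
  mass \<open>s\<close> is added to the largest count, and smallest if \<open>s\<close> is poured onto the counts like water.
\<close>

section \<open>The Dirichlet integral\<close>

text \<open>For \<open>c > 0\<close> the substitution \<open>y = c * x\<close> turns this into the
  Beta integral on the unit interval. The indicators make the formula valid for every real
  \<open>c\<close>: if \<open>c\<close> is not positive, both sides are \<open>0\<close>, also at
  \<open>c = 0\<close> since \<open>0 powr _ = 0\<close>. The iteration below needs this because the
  remaining length can become negative.\<close>

lemma nn_integral_Beta_scaled:
  fixes a b c :: real
  assumes "a > 0" "b > 0"
  shows "(\<integral>\<^sup>+y. ennreal (indicator {0..} y * y powr (a - 1) *
            (indicator {0..} (c - y) * (c - y) powr (b - 1))) \<partial>lborel) =
         ennreal (indicator {0..} c * c powr (a + b - 1) * Beta a b)"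
proof (cases "c > 0")
  case True
  let ?f = "\<lambda>y. ennreal (indicator {0..} y * y powr (a - 1) *
            (indicator {0..} (c - y) * (c - y) powr (b - 1)))"
  have B: "(\<integral>\<^sup>+x. ennreal (indicator {0..1} x * (x powr (a - 1) * (1 - x) powr (b - 1))) \<partial>lborel)
      = ennreal (Beta a b)"
    by (rule nn_integral_has_integral_lebesgue) (use has_integral_Beta_real[OF assms] in auto)
  have "(\<integral>\<^sup>+y. ?f y \<partial>lborel) = ennreal \<bar>c\<bar> * (\<integral>\<^sup>+x. ?f (0 + c * x) \<partial>lborel)"
    by (rule nn_integral_real_affine) (use True in auto)
  also have "(\<lambda>x. ?f (0 + c * x)) = (\<lambda>x. ennreal (c powr (a + b - 2)) *
      ennreal (indicator {0..1} x * (x powr (a - 1) * (1 - x) powr (b - 1))))"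
  proof
    fix x
    have 1: "c - c * x = c * (1 - x)" by (simp add: algebra_simps)
    have "c powr (a + b - 2) = c powr (a - 1) * c powr (b - 1)"
      by (subst powr_add[symmetric]) (simp add: algebra_simps)
    moreover have "0 \<le> c * x \<longleftrightarrow> 0 \<le> x" "0 \<le> c * (1 - x) \<longleftrightarrow> x \<le> 1"
      using True by (auto simp: zero_le_mult_iff)
    ultimately show "?f (0 + c * x) = ennreal (c powr (a + b - 2)) *
      ennreal (indicator {0..1} x * (x powr (a - 1) * (1 - x) powr (b - 1)))"
      unfolding add_0 1 using True
      by (auto simp: ennreal_mult'[symmetric] powr_mult indicator_def mult_ac)
  qed
  also have "ennreal \<bar>c\<bar> * (\<integral>\<^sup>+x. ennreal (c powr (a + b - 2)) *
      ennreal (indicator {0..1} x * (x powr (a - 1) * (1 - x) powr (b - 1))) \<partial>lborel)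
      = ennreal c * (ennreal (c powr (a + b - 2)) * ennreal (Beta a b))"
    using True by (subst nn_integral_cmult) (auto simp: B)
  also have "\<dots> = ennreal (c * c powr (a + b - 2) * Beta a b)"
    using True Gamma_real_pos[OF assms(1)] Gamma_real_pos[OF assms(2)] Gamma_real_pos[of "a + b"] assms
    by (simp add: ennreal_mult'[symmetric] Beta_def mult.assoc)
  also have "c * c powr (a + b - 2) = c powr (a + b - 1)"
    using True powr_add[of c 1 "a + b - 2"] by (simp add: algebra_simps)
  finally show ?thesis using True by simp
next
  case False
  have "(\<integral>\<^sup>+y. ennreal (indicator {0..} y * y powr (a - 1) *
            (indicator {0..} (c - y) * (c - y) powr (b - 1))) \<partial>lborel) = (\<integral>\<^sup>+y. 0 \<partial>(lborel::real measure))"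
    using False by (intro nn_integral_cong) (auto simp: indicator_def)
  then show ?thesis
    using False by (auto simp: indicator_def)
qed

text \<open>The factor with exponent \<open>b - 1\<close> stands for the one coordinate that is
  determined by the others. Integrating out coordinate \<open>k\<close> raises \<open>b\<close> to
  \<open>a k + b\<close>, so the induction is over all \<open>b\<close>. The factors
  \<open>Beta (a k) b\<close> produced on the way telescope to the Gamma quotient.\<close>

lemma nn_integral_Dirichlet_iterated:
  fixes a :: "'i \<Rightarrow> real"
  assumes "finite J" "\<And>i. i \<in> J \<Longrightarrow> a i > 0" "b > 0"
  shows "(\<integral>\<^sup>+y. ennreal ((\<Prod>i\<in>J. indicator {0..} (y i) * y i powr (a i - 1)) *
            (indicator {0..} (c - sum y J) * (c - sum y J) powr (b - 1))) \<partial>PiM J (\<lambda>_. lborel)) =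
         ennreal (indicator {0..} c * c powr (sum a J + b - 1) *
            ((\<Prod>i\<in>J. Gamma (a i)) * Gamma b / Gamma (sum a J + b)))"
  using assms
proof (induction J arbitrary: b rule: finite_induct)
  case empty
  interpret product_sigma_finite "\<lambda>_::'i. lborel :: real measure" by standard
  have "Gamma b \<noteq> 0" using Gamma_real_pos[OF empty(2)] by simp
  then show ?case by (simp add: PiM_empty nn_integral_count_space_finite)
next
  case (insert k J)
  interpret product_sigma_finite "\<lambda>_::'i. lborel :: real measure" by standard
  have ak: "a k > 0" using insert.prems by simp
  define P where "P y = (\<Prod>i\<in>J. indicator {0..} (y i) * y i powr (a i - 1))" for y :: "'i \<Rightarrow> real"
  have P0: "P y \<ge> 0" for y unfolding P_def by (intro prod_nonneg) auto
  let ?F = "\<lambda>J b y. ennreal ((\<Prod>i\<in>J. indicator {0..} (y i) * y i powr (a i - 1)) *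
            (indicator {0..} (c - sum y J) * (c - sum y J) powr (b - 1)))"
  have "(\<integral>\<^sup>+y. ?F (insert k J) b y \<partial>PiM (insert k J) (\<lambda>_. lborel)) =
      (\<integral>\<^sup>+x. \<integral>\<^sup>+z. ?F (insert k J) b (x(k := z)) \<partial>lborel \<partial>PiM J (\<lambda>_. lborel))"
    by (rule product_nn_integral_insert) (use insert.hyps in \<open>auto simp del: prod.insert sum.insert\<close>)
  also have "\<dots> = (\<integral>\<^sup>+x. ennreal (Beta (a k) b) * ?F J (a k + b) x \<partial>PiM J (\<lambda>_. lborel))"
  proof (intro nn_integral_cong)
    fix x :: "'i \<Rightarrow> real"
    \<comment> \<open>Coordinate \<open>k\<close> enters only through its own factor and through the
      sum. The inner integral is therefore a constant \<open>P x\<close> times a scaled Beta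
      integral of length \<open>c - sum x J\<close>.\<close>
    have *: "sum (x(k := z)) (insert k J) = z + sum x J"
            "(\<Prod>i\<in>insert k J. indicator {0..} ((x(k := z)) i) * (x(k := z)) i powr (a i - 1)) =
              indicator {0..} z * z powr (a k - 1) * P x" for z
      using insert.hyps unfolding P_def by (auto simp: prod.insert_if intro!: sum.cong prod.cong)
    have "(\<integral>\<^sup>+z. ?F (insert k J) b (x(k := z)) \<partial>lborel) =
      (\<integral>\<^sup>+z. ennreal (P x) * ennreal (indicator {0..} z * z powr (a k - 1) *
            (indicator {0..} ((c - sum x J) - z) * ((c - sum x J) - z) powr (b - 1))) \<partial>lborel)"
      unfolding * by (intro nn_integral_cong) (simp add: ennreal_mult'[symmetric] P0 algebra_simps)
    also have "\<dots> = ennreal (P x) * ennreal (indicator {0..} (c - sum x J) *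
        (c - sum x J) powr (a k + b - 1) * Beta (a k) b)"
      by (subst nn_integral_cmult) (auto simp: nn_integral_Beta_scaled[OF ak insert.prems(2)])
    also have "\<dots> = ennreal (Beta (a k) b) * ?F J (a k + b) x"
      using P0[of x] Gamma_real_pos[of "a k"] Gamma_real_pos[of b] Gamma_real_pos[of "a k + b"] ak insert.prems(2)
      unfolding P_def[symmetric] by (simp add: ennreal_mult'[symmetric] ennreal_mult''[symmetric] mult_ac Beta_def)
    finally show "(\<integral>\<^sup>+z. ?F (insert k J) b (x(k := z)) \<partial>lborel) = ennreal (Beta (a k) b) * ?F J (a k + b) x" .
  qed
  also have "\<dots> = ennreal (Beta (a k) b) * (\<integral>\<^sup>+x. ?F J (a k + b) x \<partial>PiM J (\<lambda>_. lborel))"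
    by (rule nn_integral_cmult) simp
  also have "(\<integral>\<^sup>+x. ?F J (a k + b) x \<partial>PiM J (\<lambda>_. lborel)) =
      ennreal (indicator {0..} c * c powr (sum a J + (a k + b) - 1) *
            ((\<Prod>i\<in>J. Gamma (a i)) * Gamma (a k + b) / Gamma (sum a J + (a k + b))))"
    by (rule insert.IH) (use insert.prems in \<open>auto simp: add_pos_pos\<close>)
  also have "ennreal (Beta (a k) b) * \<dots> = ennreal (Beta (a k) b * (indicator {0..} c *
     c powr (sum a J + (a k + b) - 1) *
            ((\<Prod>i\<in>J. Gamma (a i)) * Gamma (a k + b) / Gamma (sum a J + (a k + b)))))"
    using Gamma_real_pos[of "a k"] Gamma_real_pos[of b] Gamma_real_pos[of "a k + b"] ak insert.prems(2)
    by (subst ennreal_mult') (auto simp: Beta_def)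
  also have "Beta (a k) b * (indicator {0..} c * c powr (sum a J + (a k + b) - 1) *
            ((\<Prod>i\<in>J. Gamma (a i)) * Gamma (a k + b) / Gamma (sum a J + (a k + b)))) =
     indicator {0..} c * c powr (sum a (insert k J) + b - 1) *
            ((\<Prod>i\<in>insert k J. Gamma (a i)) * Gamma b / Gamma (sum a (insert k J) + b))"
    using insert.hyps Gamma_real_pos[OF add_pos_pos[OF insert.prems(2) ak]]
    by (simp add: Beta_def algebra_simps)
  finally show ?case .
qed

section \<open>The normalising constant of the Dirichlet weight\<close>

lemma measurable_prob_simplex [measurable]:
  "prob_simplex d \<in> sets (PiM {1..d} (\<lambda>_. borel))"
proof -
  have "prob_simplex d = {x \<in> space (PiM {1..d} (\<lambda>_. borel)).
      (\<forall>i\<in>{1..d}. 0 \<le> x i) \<and> (\<Sum>i=1..d. x i) = 1}"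
    by (auto simp: prob_simplex_def space_PiM PiE_def Pi_def)
  also have "\<dots> \<in> sets (PiM {1..d} (\<lambda>_. borel))"
    by measurable
  finally show ?thesis .
qed

lemma measurable_dirichlet_weight [measurable]:
  "dirichlet_weight d a \<in> borel_measurable (PiM {1..d} (\<lambda>_. borel))"
  unfolding dirichlet_weight_def by measurable

lemma dirichlet_weight_nonneg: "dirichlet_weight d a p \<ge> 0"
  unfolding dirichlet_weight_def by (intro mult_nonneg_nonneg prod_nonneg) auto

lemma sets_hyperplane_lebesgue [measurable_cong]:
  "sets (hyperplane_lebesgue d) = sets (PiM {1..d} (\<lambda>_. borel))"
  by (simp add: hyperplane_lebesgue_def)

lemma nn_integral_hyperplane_lebesgue:
  assumes "f \<in> borel_measurable (PiM {1..d} (\<lambda>_. borel))" "d \<ge> 1"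
  shows "(\<integral>\<^sup>+p. f p \<partial>hyperplane_lebesgue d) =
    (\<integral>\<^sup>+y. f (y(d := 1 - (\<Sum>i=1..<d. y i))) \<partial>PiM {1..<d} (\<lambda>_. lborel))"
  unfolding hyperplane_lebesgue_def
proof (rule nn_integral_distr)
  have "insert d {1..<d} = {1..d}" using assms by auto
  moreover have "(\<lambda>y. y(d := 1 - (\<Sum>i=1..<d. y i))) \<in>
      PiM {1..<d} (\<lambda>_. lborel) \<rightarrow>\<^sub>M PiM (insert d {1..<d}) (\<lambda>_. borel :: real measure)"
  proof (rule measurable_fun_upd)
    show "(\<lambda>y. y) \<in> PiM {1..<d} (\<lambda>_. lborel) \<rightarrow>\<^sub>M PiM {1..<d} (\<lambda>_. borel :: real measure)"
      by (rule measurable_ident_sets) (simp cong: sets_PiM_cong)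
  qed auto
  ultimately show "(\<lambda>y. y(d := 1 - (\<Sum>i=1..<d. y i))) \<in>
      PiM {1..<d} (\<lambda>_. lborel) \<rightarrow>\<^sub>M PiM {1..d} (\<lambda>_. borel :: real measure)" by simp
qed (use assms in simp)

text \<open>This is the iterated integral with \<open>c = 1\<close> and the dependent coordinate
  \<open>d\<close> in the role of the last factor, that is \<open>b = a d\<close>. For
  \<open>d = 1\<close> the iterated integral is over the empty product.\<close>

lemma dirichlet_mass_eq:
  assumes "d \<ge> 1" "\<And>i. i \<in> {1..d} \<Longrightarrow> a i > 0"
  shows "dirichlet_mass d a = ennreal ((\<Prod>i=1..d. Gamma (a i)) / Gamma (\<Sum>i=1..d. a i))"
proof -
  have eq: "{1..d} = insert d {1..<d}" using assms(1) by auto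
  have "dirichlet_mass d a = (\<integral>\<^sup>+y. ennreal (dirichlet_weight d a (y(d := 1 - (\<Sum>i=1..<d. y i))))
       \<partial>PiM {1..<d} (\<lambda>_. lborel))"
    unfolding dirichlet_mass_def by (rule nn_integral_hyperplane_lebesgue) (measurable, use assms in simp)
  also have "\<dots> = (\<integral>\<^sup>+y. ennreal ((\<Prod>i\<in>{1..<d}. indicator {0..} (y i) * y i powr (a i - 1)) *
            (indicator {0..} (1 - sum y {1..<d}) * (1 - sum y {1..<d}) powr (a d - 1)))
       \<partial>PiM {1..<d} (\<lambda>_. lborel))"
  proof (rule nn_integral_cong)
    fix y :: "nat \<Rightarrow> real" assume "y \<in> space (PiM {1..<d} (\<lambda>_. lborel))"
    \<comment> \<open>Points of \<open>prob_simplex d\<close> are extensional, so membership of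
      \<open>?p\<close> also depends on the values outside the index range.\<close>
    then have ext: "i \<notin> {1..<d} \<Longrightarrow> y i = undefined" for i by (auto simp: space_PiM PiE_def extensional_def)
    let ?p = "y(d := 1 - (\<Sum>i=1..<d. y i))"
    have s: "(\<Sum>i=1..d. ?p i) = 1" unfolding eq by (subst sum.insert) (auto intro!: sum.cong)
    have "?p \<in> prob_simplex d \<longleftrightarrow> (\<forall>i\<in>{1..<d}. 0 \<le> y i) \<and> 0 \<le> 1 - (\<Sum>i=1..<d. y i)"
      unfolding prob_simplex_def using s ext assms(1) by (auto simp: PiE_def Pi_def extensional_def Ball_def)
    moreover have "(\<Prod>i\<in>{1..<d}. indicator {0..} (y i)) = (if (\<forall>i\<in>{1..<d}. 0 \<le> y i) then 1 else (0::real))"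
      by (auto simp: indicator_def intro!: prod.neutral)
    moreover have "(\<Prod>i=1..d. ?p i powr (a i - 1)) =
        (\<Prod>i\<in>{1..<d}. y i powr (a i - 1)) * (1 - (\<Sum>i=1..<d. y i)) powr (a d - 1)"
      unfolding eq by (subst prod.insert) (auto intro!: prod.cong)
    ultimately show "ennreal (dirichlet_weight d a ?p) =
       ennreal ((\<Prod>i\<in>{1..<d}. indicator {0..} (y i) * y i powr (a i - 1)) *
            (indicator {0..} (1 - sum y {1..<d}) * (1 - sum y {1..<d}) powr (a d - 1)))"
      unfolding dirichlet_weight_def prod.distrib by (auto simp: indicator_def)
  qed
  also have "\<dots> = ennreal (indicator {0..} (1::real) * 1 powr (sum a {1..<d} + a d - 1) *
            ((\<Prod>i\<in>{1..<d}. Gamma (a i)) * Gamma (a d) / Gamma (sum a {1..<d} + a d)))"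
    by (rule nn_integral_Dirichlet_iterated) (use assms in auto)
  also have "\<dots> = ennreal ((\<Prod>i=1..d. Gamma (a i)) / Gamma (\<Sum>i=1..d. a i))"
    unfolding eq by (subst sum.insert, simp, simp, subst prod.insert) (auto simp: mult_ac add_ac)
  finally show ?thesis .
qed

lemma prob_simplexD:
  assumes "p \<in> prob_simplex d" "i \<in> {1..d}"
  shows "0 \<le> p i" "p i \<le> 1"
proof -
  have nn: "\<And>j. j \<in> {1..d} \<Longrightarrow> 0 \<le> p j" and s: "(\<Sum>j=1..d. p j) = 1"
    using assms(1) by (auto simp: prob_simplex_def)
  show "0 \<le> p i" using nn assms(2) .
  show "p i \<le> 1"
    using member_le_sum[of i "{1..d}" p] nn s assms(2) by auto
qed

section \<open>Improper parameters\<close>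

text \<open>On the simplex all coordinates lie between \<open>0\<close> and \<open>1\<close>, where
  \<open>powr\<close> decreases in the exponent.\<close>

lemma dirichlet_mass_antimono:
  assumes "\<And>i. i \<in> {1..d} \<Longrightarrow> a i \<le> b i"
  shows "dirichlet_mass d b \<le> dirichlet_mass d a"
  unfolding dirichlet_mass_def
proof (rule nn_integral_mono)
  fix p
  show "ennreal (dirichlet_weight d b p) \<le> ennreal (dirichlet_weight d a p)"
  proof (cases "p \<in> prob_simplex d")
    case True
    then have "(\<Prod>i=1..d. p i powr (b i - 1)) \<le> (\<Prod>i=1..d. p i powr (a i - 1))"
      using prob_simplexD[OF True] assms by (intro prod_mono) (auto intro!: powr_mono')
    then show ?thesis using True by (simp add: dirichlet_weight_def ennreal_leI)
  qed (simp add: dirichlet_weight_def)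
qed

text \<open>
  If the mass were finite, it would bound the masses for the positive parameters \<open>a + \<epsilon>\<close>,
  whose reciprocals tend to \<open>0\<close> because \<open>rGamma\<close> is continuous and vanishes at \<open>0\<close>.
\<close>

lemma dirichlet_mass_infinite:
  assumes "\<And>i. i \<in> {1..d} \<Longrightarrow> a i \<ge> 0" "k \<in> {1..d}" "a k = 0" "(\<Sum>i=1..d. a i) > 0"
  shows "dirichlet_mass d a = \<infinity>"
proof (rule ccontr)
  assume "dirichlet_mass d a \<noteq> \<infinity>"
  then obtain M where M: "dirichlet_mass d a = ennreal M" "M \<ge> 0"
    by (cases "dirichlet_mass d a") auto
  have d: "d \<ge> 1" using assms(2) by simp
  have le: "rGamma (\<Sum>i=1..d. a i + e) \<le> M * (\<Prod>i=1..d. rGamma (a i + e))" if e: "e > 0" for e :: real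
  proof -
    have pos: "a i + e > 0" if "i \<in> {1..d}" for i using assms(1)[OF that] e by simp
    have "ennreal ((\<Prod>i=1..d. Gamma (a i + e)) / Gamma (\<Sum>i=1..d. a i + e)) = dirichlet_mass d (\<lambda>i. a i + e)"
      by (rule dirichlet_mass_eq[symmetric]) (use d pos in auto)
    also have "\<dots> \<le> ennreal M"
      unfolding M(1)[symmetric] by (rule dirichlet_mass_antimono) (use e in auto)
    finally have *: "(\<Prod>i=1..d. Gamma (a i + e)) / Gamma (\<Sum>i=1..d. a i + e) \<le> M"
      using M(2) by simp
    have "(\<Prod>i=1..d. Gamma (a i + e)) > 0" using pos by (intro prod_pos) (auto intro: Gamma_real_pos)
    then have "1 / Gamma (\<Sum>i=1..d. a i + e) \<le> M / (\<Prod>i=1..d. Gamma (a i + e))"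
      using * by (simp add: field_simps)
    then show ?thesis by (simp add: rGamma_inverse_Gamma prod_inversef[symmetric] divide_inverse comp_def)
  qed
  have "rGamma (\<Sum>i=1..d. a i + 0) \<le> M * (\<Prod>i=1..d. rGamma (a i + 0))"
  proof (rule tendsto_le)
    have "isCont (\<lambda>e. M * (\<Prod>i=1..d. rGamma (a i + e))) 0"
      by (intro continuous_intros)
    then show "((\<lambda>e. M * (\<Prod>i=1..d. rGamma (a i + e))) \<longlongrightarrow> M * (\<Prod>i=1..d. rGamma (a i + 0))) (at_right 0)"
      by (intro filterlim_mono[OF isContD[where x = 0]]) (auto simp: at_le)
    have "isCont (\<lambda>e. rGamma (\<Sum>i=1..d. a i + e)) 0"
      by (intro continuous_intros)
    then show "((\<lambda>e. rGamma (\<Sum>i=1..d. a i + e)) \<longlongrightarrow> rGamma (\<Sum>i=1..d. a i + 0)) (at_right 0)"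
      by (intro filterlim_mono[OF isContD[where x = 0]]) (auto simp: at_le)
    show "\<forall>\<^sub>F e in at_right 0. rGamma (\<Sum>i=1..d. a i + e) \<le> M * (\<Prod>i=1..d. rGamma (a i + e))"
      using le by (auto intro: eventually_at_rightI[of 0 1])
  qed simp
  moreover have "(\<Prod>i=1..d. rGamma (a i + 0)) = 0"
    using assms(2,3) by (intro prod_zero bexI[of _ k]) auto
  moreover have "rGamma (\<Sum>i=1..d. a i) > 0"
    using assms(4) Gamma_real_pos[OF assms(4)] by (simp add: rGamma_inverse_Gamma)
  ultimately show False by (simp only: add_0_right mult_zero_right)
qed

section \<open>Moments and expected entropy\<close>

text \<open>The quotient is at most \<open>0\<close> since \<open>p <= 1\<close>. From below,
  \<open>p powr e >= 1 + e * ln p\<close> bounds it by \<open>p * ln p\<close>, and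
  \<open>ln (1 / p) <= 1 / p - 1\<close> shows that \<open>p * (- ln p)\<close> is at most
  \<open>1 - p\<close>.\<close>

lemma powr_quotient_bound:
  fixes p e :: real
  assumes "0 \<le> p" "p \<le> 1" "e > 0"
  shows "norm ((p powr (1 + e) - p powr 1) / e) \<le> 1"
proof (cases "p = 0")
  case False
  then have p: "p > 0" using assms by simp
  have "1 + e * ln p \<le> p powr e" using p by (simp add: powr_def)
  then have "p * (1 + e * ln p) \<le> p powr (1 + e)"
    using p by (simp add: powr_add mult_left_mono)
  moreover have "p * (- ln p) \<le> 1"
  proof -
    have "ln (1 / p) \<le> 1 / p - 1" using p by (intro ln_le_minus_one) auto
    then have "p * (- ln p) \<le> p * (1 / p - 1)" using p by (intro mult_left_mono) (auto simp: ln_div)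
    then show ?thesis using p by (simp add: algebra_simps)
  qed
  moreover have "e * (p * (- ln p)) \<le> e * 1" using calculation(2) assms by (intro mult_left_mono) auto
  moreover have "p powr (1 + e) \<le> p powr 1" using assms by (intro powr_mono') auto
  ultimately show ?thesis using p assms by (simp add: field_simps abs_if)
qed simp

locale dirichlet_positive =
  fixes d :: nat and a :: "nat \<Rightarrow> real"
  assumes d_ge_1: "d \<ge> 1"
  assumes a_pos: "i \<in> {1..d} \<Longrightarrow> a i > 0"
begin

definition total :: real where "total = (\<Sum>i=1..d. a i)"

lemma total_pos: "total > 0"
  unfolding total_def using d_ge_1 a_pos by (intro sum_pos) auto

lemma mass_pos: "(\<Prod>i=1..d. Gamma (a i)) / Gamma total > 0"
  using a_pos total_pos by (intro divide_pos_pos prod_pos) (auto intro: Gamma_real_pos)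

lemma mass_eq: "dirichlet_mass d a = ennreal ((\<Prod>i=1..d. Gamma (a i)) / Gamma total)"
  unfolding total_def by (rule dirichlet_mass_eq) (use d_ge_1 a_pos in auto)

lemma sets_dirichlet [measurable_cong]: "sets (dirichlet d a) = sets (PiM {1..d} (\<lambda>_. borel))"
  by (simp add: dirichlet_def sets_hyperplane_lebesgue)

lemma AE_dirichlet: "AE p in dirichlet d a. p \<in> prob_simplex d"
  unfolding dirichlet_def
  by (subst AE_density) (auto simp: dirichlet_weight_def indicator_def intro!: AE_I2)

lemma prob_space_dirichlet: "prob_space (dirichlet d a)"
proof
  have "emeasure (dirichlet d a) (space (dirichlet d a)) =
      (\<integral>\<^sup>+p. ennreal (dirichlet_weight d a p) / dirichlet_mass d a \<partial>hyperplane_lebesgue d)"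
    unfolding dirichlet_def by (simp add: emeasure_density cong: nn_integral_cong)
  also have "\<dots> = dirichlet_mass d a / dirichlet_mass d a"
    unfolding dirichlet_mass_def by (rule nn_integral_divide) measurable
  also have "\<dots> = 1"
  proof -
    have "ennreal x / ennreal x = 1" if "x > 0" for x using that by (simp add: divide_ennreal)
    from this[OF mass_pos] show ?thesis unfolding mass_eq .
  qed
  finally show "emeasure (dirichlet d a) (space (dirichlet d a)) = 1" .
qed

text \<open>Multiplying the weight by \<open>p i powr x\<close> gives the weight with
  \<open>a i\<close> raised by \<open>x\<close>, so the moment is a quotient of two masses. In it
  all Gamma factors cancel except those of coordinate \<open>i\<close> and of the total.\<close>

lemma nn_integral_dirichlet_powr:
  assumes "i \<in> {1..d}" "x \<ge> 0"
  shows "(\<integral>\<^sup>+p. ennreal (p i powr x) \<partial>dirichlet d a) =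
    ennreal (Gamma (a i + x) * Gamma total / (Gamma (a i) * Gamma (total + x)))"
proof -
  let ?b = "a(i := a i + x)"
  interpret b: dirichlet_positive d ?b
    using d_ge_1 a_pos assms by unfold_locales (auto intro: add_pos_nonneg)
  have [measurable]: "(\<lambda>p. p i) \<in> borel_measurable (PiM {1..d} (\<lambda>_. borel))"
    using assms(1) by (rule measurable_component_singleton)
  have eq: "{1..d} = insert i ({1..d} - {i})" using assms by auto
  have bt: "b.total = total + x"
    unfolding b.total_def total_def by (subst (1 2) eq) (subst (1 2) sum.insert, auto intro!: sum.cong)
  have bp: "(\<Prod>j=1..d. Gamma (?b j)) = Gamma (a i + x) / Gamma (a i) * (\<Prod>j=1..d. Gamma (a j))"
    using Gamma_real_pos[OF a_pos[OF assms(1)]]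
    by (subst (1 2) eq) (subst (1 2) prod.insert, auto intro!: prod.cong)
  have "(\<integral>\<^sup>+p. ennreal (p i powr x) \<partial>dirichlet d a) =
      (\<integral>\<^sup>+p. ennreal (dirichlet_weight d a p) / dirichlet_mass d a * ennreal (p i powr x) \<partial>hyperplane_lebesgue d)"
    unfolding dirichlet_def by (rule nn_integral_density) measurable
  also have "\<dots> = (\<integral>\<^sup>+p. ennreal (dirichlet_weight d ?b p) / dirichlet_mass d a \<partial>hyperplane_lebesgue d)"
  proof (rule nn_integral_cong)
    fix p
    have "dirichlet_weight d ?b p = dirichlet_weight d a p * p i powr x"
    proof (cases "p \<in> prob_simplex d")
      case True
      have "p i powr (a i + x - 1) = p i powr (a i - 1) * p i powr x"
        by (subst powr_add[symmetric]) (simp add: algebra_simps)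
      then have "(\<Prod>j=1..d. p j powr (?b j - 1)) = (\<Prod>j=1..d. p j powr (a j - 1)) * p i powr x"
        by (subst (1 2) eq) (subst (1 2) prod.insert, auto intro!: prod.cong)
      then show ?thesis by (simp add: dirichlet_weight_def)
    qed (simp add: dirichlet_weight_def)
    then show "ennreal (dirichlet_weight d a p) / dirichlet_mass d a * ennreal (p i powr x) =
        ennreal (dirichlet_weight d ?b p) / dirichlet_mass d a"
      by (simp add: ennreal_mult dirichlet_weight_nonneg ennreal_times_divide mult.commute)
  qed
  also have "\<dots> = dirichlet_mass d ?b / dirichlet_mass d a"
    unfolding dirichlet_mass_def[of d ?b] by (rule nn_integral_divide) measurable
  also have "\<dots> = ennreal (((\<Prod>j=1..d. Gamma (?b j)) / Gamma b.total) / ((\<Prod>i=1..d. Gamma (a i)) / Gamma total))"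
    using mass_pos b.mass_pos unfolding mass_eq b.mass_eq by (intro divide_ennreal) auto
  also have "((\<Prod>j=1..d. Gamma (?b j)) / Gamma b.total) / ((\<Prod>i=1..d. Gamma (a i)) / Gamma total) =
      Gamma (a i + x) * Gamma total / (Gamma (a i) * Gamma (total + x))"
  proof -
    have "(\<Prod>i=1..d. Gamma (a i)) > 0" using a_pos by (intro prod_pos) (auto intro: Gamma_real_pos)
    moreover have "(A / B * P / C) / (P / T) = A * T / (B * C)" if "P > 0" for A B C P T :: real
      using that by (simp add: field_simps)
    ultimately show ?thesis unfolding bp bt by blast
  qed
  finally show ?thesis .
qed

lemma
  assumes "i \<in> {1..d}" "x \<ge> 0"
  shows integrable_dirichlet_powr: "integrable (dirichlet d a) (\<lambda>p. p i powr x)"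
    and integral_dirichlet_powr: "(\<integral>p. p i powr x \<partial>dirichlet d a) =
    Gamma (a i + x) * Gamma total / (Gamma (a i) * Gamma (total + x))"
proof -
  have [measurable]: "(\<lambda>p. p i) \<in> borel_measurable (PiM {1..d} (\<lambda>_. borel))"
    using assms(1) by (rule measurable_component_singleton)
  show "integrable (dirichlet d a) (\<lambda>p. p i powr x)"
    by (intro integrableI_nonneg) (auto simp: nn_integral_dirichlet_powr[OF assms])
  have "Gamma (a i + x) * Gamma total / (Gamma (a i) * Gamma (total + x)) \<ge> 0"
    using a_pos[OF assms(1)] total_pos assms(2)
    by (intro divide_nonneg_nonneg mult_nonneg_nonneg) (auto intro!: less_imp_le[OF Gamma_real_pos])
  then show "(\<integral>p. p i powr x \<partial>dirichlet d a) =
    Gamma (a i + x) * Gamma total / (Gamma (a i) * Gamma (total + x))"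
    by (subst integral_eq_nn_integral) (auto simp: nn_integral_dirichlet_powr[OF assms])
qed

lemma integral_dirichlet_ln:
  assumes "i \<in> {1..d}"
  shows "integrable (dirichlet d a) (\<lambda>p. p i * ln (p i))"
    and "(\<integral>p. p i * ln (p i) \<partial>dirichlet d a) =
      a i / total * (Digamma (a i + 1) - Digamma (total + 1))"
proof -
  interpret prob_space "dirichlet d a" by (rule prob_space_dirichlet)
  have [measurable]: "(\<lambda>p. p i) \<in> borel_measurable (PiM {1..d} (\<lambda>_. borel))"
    using assms(1) by (rule measurable_component_singleton)
  \<comment> \<open>Dominated convergence is applied along a sequence, so the difference quotient is
    taken along these positive steps tending to \<open>0\<close>.\<close>
  define e where "e k = inverse (real (Suc k))" for k
  have e_pos: "e k > 0" for k by (simp add: e_def)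
  have "e \<longlonglongrightarrow> 0" unfolding e_def by (rule LIMSEQ_inverse_real_of_nat)
  then have e_lim: "filterlim e (at 0) sequentially"
    using e_pos by (auto simp: filterlim_at less_imp_neq[symmetric])
  define f where "f k p = (p i powr (1 + e k) - p i powr 1) / e k" for k and p :: "nat \<Rightarrow> real"
  \<comment> \<open>The moment of order \<open>x\<close> as a function of \<open>x\<close>. The
    integral of \<open>f k\<close> is its difference quotient at \<open>1\<close>, so the limit can
    be computed in two ways.\<close>
  define m where "m x = Gamma (a i + x) * Gamma total / (Gamma (a i) * Gamma (total + x))" for x
  note ai = a_pos[OF assms]
  have lim: "AE p in dirichlet d a. (\<lambda>k. f k p) \<longlonglongrightarrow> p i * ln (p i)"
    using AE_dirichlet
  proof eventually_elim
    case (elim p)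
    show ?case
    \<comment> \<open>At \<open>p i = 0\<close> every \<open>f k p\<close> and the limit are
      \<open>0\<close>, by the values \<open>0 powr _ = 0\<close> and
      \<open>0 * ln 0 = 0\<close>.\<close>
    proof (cases "p i = 0")
      case False
      then have p: "p i > 0" using prob_simplexD[OF elim assms] by simp
      have "((\<lambda>x. p i powr x) has_field_derivative p i * ln (p i)) (at 1)"
        using p by (auto intro!: derivative_eq_intros)
      then have "((\<lambda>h. (p i powr (1 + h) - p i powr 1) / h) \<longlongrightarrow> p i * ln (p i)) (at 0)"
        by (simp add: DERIV_def)
      from filterlim_compose[OF this e_lim] show ?thesis by (simp add: f_def)
    qed (simp add: f_def)
  qed
  have bound: "AE p in dirichlet d a. norm (f k p) \<le> 1" for k
    using AE_dirichlet
  proof eventually_elim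
    case (elim p)
    then show ?case
      unfolding f_def by (intro powr_quotient_bound prob_simplexD[OF elim assms] e_pos)
  qed
  have meas: "(\<lambda>p. p i * ln (p i)) \<in> borel_measurable (dirichlet d a)" by measurable
  have fmeas: "f k \<in> borel_measurable (dirichlet d a)" for k unfolding f_def by measurable
  show "integrable (dirichlet d a) (\<lambda>p. p i * ln (p i))"
    by (rule integrable_dominated_convergence[OF meas fmeas _ lim bound]) simp
  have "(\<lambda>k. \<integral>p. f k p \<partial>dirichlet d a) \<longlonglongrightarrow> (\<integral>p. p i * ln (p i) \<partial>dirichlet d a)"
    by (rule integral_dominated_convergence[OF meas fmeas _ lim bound]) simp
  also have "(\<lambda>k. \<integral>p. f k p \<partial>dirichlet d a) = (\<lambda>k. (m (1 + e k) - m 1) / e k)"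
  proof
    fix k
    have nn: "1 + e k \<ge> 0" "(1::real) \<ge> 0" using e_pos[of k] by simp_all
    have "(\<integral>p. f k p \<partial>dirichlet d a) =
        (\<integral>p. p i powr (1 + e k) - p i powr 1 \<partial>dirichlet d a) / e k"
      unfolding f_def by (rule integral_divide_zero)
    also have "(\<integral>p. p i powr (1 + e k) - p i powr 1 \<partial>dirichlet d a) = m (1 + e k) - m 1"
      unfolding m_def integral_dirichlet_powr[OF assms nn(1), symmetric]
        integral_dirichlet_powr[OF assms nn(2), symmetric]
      by (intro Bochner_Integration.integral_diff integrable_dirichlet_powr assms nn)
    finally show "(\<integral>p. f k p \<partial>dirichlet d a) = (m (1 + e k) - m 1) / e k" .
  qed
  finally have L1: "(\<lambda>k. (m (1 + e k) - m 1) / e k) \<longlonglongrightarrow> (\<integral>p. p i * ln (p i) \<partial>dirichlet d a)" .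
  have n1: "a i + 1 \<notin> \<int>\<^sub>\<le>\<^sub>0" "total + 1 \<notin> \<int>\<^sub>\<le>\<^sub>0"
    using ai total_pos by (auto elim!: nonpos_Ints_cases)
  have "a i \<notin> \<int>\<^sub>\<le>\<^sub>0" "total \<notin> \<int>\<^sub>\<le>\<^sub>0" using ai total_pos by (auto elim!: nonpos_Ints_cases)
  then have G1: "Gamma (a i + 1) = a i * Gamma (a i)" "Gamma (total + 1) = total * Gamma total"
    by (auto simp: Gamma_plus1)
  have G0: "Gamma (a i) \<noteq> 0" "Gamma total \<noteq> 0"
    using Gamma_real_pos[OF ai] Gamma_real_pos[OF total_pos] by auto
  \<comment> \<open>The logarithmic derivative of \<open>m\<close> at \<open>1\<close> is the
    difference of digamma values, and \<open>m 1 = a i / total\<close> by the recurrence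
    \<open>G1\<close>.\<close>
  have "(m has_field_derivative a i / total * (Digamma (a i + 1) - Digamma (total + 1))) (at 1)"
    unfolding m_def using n1 G0 G1 ai total_pos
    by (auto intro!: derivative_eq_intros simp: field_simps power2_eq_square)
  then have "((\<lambda>h. (m (1 + h) - m 1) / h) \<longlongrightarrow> a i / total * (Digamma (a i + 1) - Digamma (total + 1))) (at 0)"
    by (simp add: DERIV_def)
  from filterlim_compose[OF this e_lim] L1
  show "(\<integral>p. p i * ln (p i) \<partial>dirichlet d a) = a i / total * (Digamma (a i + 1) - Digamma (total + 1))"
    using LIMSEQ_unique by blast
qed

lemma integral_dirichlet_entropy:
  "(\<integral>p. vec_entropy d p \<partial>dirichlet d a) =
    (\<Sum>i=1..d. a i / total * (Digamma (total + 1) - Digamma (a i + 1)))"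
  unfolding vec_entropy_def
  by (simp add: integral_dirichlet_ln sum_negf[symmetric] right_diff_distrib)

end

section \<open>Convexity and majorisation\<close>

lemma convex_on_pointwise_limit:
  fixes f :: "nat \<Rightarrow> 'a::real_vector \<Rightarrow> real"
  assumes "\<And>k. convex_on S (f k)" "\<And>x. x \<in> S \<Longrightarrow> (\<lambda>k. f k x) \<longlonglongrightarrow> g x"
  shows "convex_on S g"
proof
  show conv: "convex S" using assms(1) by (simp add: convex_on_def)
  fix t :: real and x y
  assume t: "0 < t" "t < 1" and xy: "x \<in> S" "y \<in> S"
  have "(1 - t) *\<^sub>R x + t *\<^sub>R y \<in> S" using conv t xy by (intro convexD_alt) auto
  then show "g ((1 - t) *\<^sub>R x + t *\<^sub>R y) \<le> (1 - t) * g x + t * g y"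
    using t xy convex_onD[OF assms(1)]
    by (intro LIMSEQ_le[OF assms(2) tendsto_add[OF tendsto_mult_left[OF assms(2)] tendsto_mult_left[OF assms(2)]]])
       auto
qed

text \<open>In the limit formula for \<open>Digamma (x + 1)\<close>, multiplication by
  \<open>x\<close> turns each summand into
  \<open>- x / (x + k + 1) = (k + 1) / (x + k + 1) - 1\<close>, which has a positive second
  derivative. The domain reaches down to \<open>-1\<close> so that \<open>0\<close>, the parameter
  of an unobserved outcome with no prior weight, is an interior point with a tangent.\<close>

lemma convex_on_mult_Digamma: "convex_on {-1<..} (\<lambda>x::real. x * Digamma (x + 1))"
proof (rule convex_on_pointwise_limit)
  let ?f = "\<lambda>m x. x * ln (real m) + (\<Sum>k<m. real (k + 1) * inverse (x + real (k + 1)) - 1)"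
  let ?f' = "\<lambda>m x. ln (real m) + (\<Sum>k<m. - real (k + 1) / (x + real (k + 1)) ^ 2)"
  let ?f'' = "\<lambda>m x. (\<Sum>k<m. 2 * real (k + 1) / (x + real (k + 1)) ^ 3)"
  fix m
  show "convex_on {-1<..} (?f m)"
  proof (rule f''_ge0_imp_convex)
    fix x :: real assume "x \<in> {-1<..}"
    then have pos: "x + real (k + 1) > 0" for k by auto
    have "((\<lambda>x. real (k + 1) * inverse (x + real (k + 1)) - 1) has_real_derivative
         - real (k + 1) / (x + real (k + 1)) ^ 2) (at x)" for k
      using pos[of k] by (auto intro!: derivative_eq_intros simp: field_simps power2_eq_square)
    then show "(?f m has_real_derivative ?f' m x) (at x)"
      by (intro DERIV_add DERIV_sum) (auto intro!: derivative_eq_intros)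
    have "((\<lambda>x. - real (k + 1) / (x + real (k + 1)) ^ 2) has_real_derivative
         2 * real (k + 1) / (x + real (k + 1)) ^ 3) (at x)" for k
      using pos[of k]
      by (auto intro!: derivative_eq_intros simp: divide_simps) (simp add: algebra_simps eval_nat_numeral)
    \<comment> \<open>The summand \<open>0\<close> is the derivative of the constant
      \<open>ln (real m)\<close> and gives the sum the shape expected by
      \<open>DERIV_add\<close>.\<close>
    then have "(?f' m has_real_derivative 0 + ?f'' m x) (at x)"
      by (intro DERIV_add DERIV_sum) auto
    then show "(?f' m has_real_derivative ?f'' m x) (at x)" by simp
    show "?f'' m x \<ge> 0" using pos by (intro sum_nonneg divide_nonneg_nonneg zero_le_power less_imp_le[OF pos]) auto
  qed simp
next
  fix x :: real assume x: "x \<in> {-1<..}"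
  have "(\<lambda>m. x * (ln (real m) - (\<Sum>k<m. inverse (x + 1 + real k)))) \<longlonglongrightarrow> x * Digamma (x + 1)"
    using Digamma_LIMSEQ[of "x + 1"] x by (intro tendsto_mult_left) auto
  also have "(\<lambda>m. x * (ln (real m) - (\<Sum>k<m. inverse (x + 1 + real k)))) =
    (\<lambda>m. x * ln (real m) + (\<Sum>k<m. real (k + 1) * inverse (x + real (k + 1)) - 1))"
  proof
    fix m
    have "- (x * inverse (x + 1 + real k)) = real (k + 1) * inverse (x + real (k + 1)) - 1" for k
      using x by (simp add: field_simps)
    then have "(\<Sum>k<m. real (k + 1) * inverse (x + real (k + 1)) - 1) = - (x * (\<Sum>k<m. inverse (x + 1 + real k)))"
      by (simp add: sum_distrib_left sum_negf[symmetric])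
    then show "x * (ln (real m) - (\<Sum>k<m. inverse (x + 1 + real k))) =
        x * ln (real m) + (\<Sum>k<m. real (k + 1) * inverse (x + real (k + 1)) - 1)"
      by (simp add: algebra_simps)
  qed
  finally show "(\<lambda>m. x * ln (real m) + (\<Sum>k<m. real (k + 1) * inverse (x + real (k + 1)) - 1))
      \<longlonglongrightarrow> x * Digamma (x + 1)" .
qed

lemma has_field_derivative_mult_Digamma:
  fixes x :: real
  assumes "x > -1"
  shows "((\<lambda>x. x * Digamma (x + 1)) has_field_derivative
    Digamma (x + 1) + x * Polygamma 1 (x + 1)) (at x within A)"
proof -
  have "x + 1 \<notin> \<int>\<^sub>\<le>\<^sub>0" using assms by (auto elim!: nonpos_Ints_cases)
  then show ?thesis by (auto intro!: derivative_eq_intros)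
qed

text \<open>Both \<open>x + h\<close> and \<open>y\<close> lie between \<open>x\<close> and
  \<open>y + h\<close>, with the weights \<open>w\<close> and \<open>1 - w\<close> exchanged. Adding
  the two convexity inequalities gives the claim. If \<open>y + h = x\<close>, then
  \<open>h = 0\<close> and \<open>x = y\<close>.\<close>

lemma convex_on_increments_mono:
  fixes g :: "real \<Rightarrow> real"
  assumes g: "convex_on S g" and S: "x \<in> S" "y + h \<in> S" and "x \<le> y" "h \<ge> 0"
  shows "g (x + h) - g x \<le> g (y + h) - g y"
proof (cases "y + h = x")
  case False
  define w where "w = h / (y + h - x)"
  have w: "0 \<le> w" "w \<le> 1" using assms False by (auto simp: w_def field_simps)
  have wh: "w * (y + h - x) = h" using False by (simp add: w_def)
  have "g ((1 - w) *\<^sub>R x + w *\<^sub>R (y + h)) \<le> (1 - w) * g x + w * g (y + h)"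
    using w S by (intro convex_onD[OF g]) auto
  moreover have "g ((1 - w) *\<^sub>R (y + h) + w *\<^sub>R x) \<le> (1 - w) * g (y + h) + w * g x"
    using w S by (intro convex_onD[OF g]) auto
  moreover have "(1 - w) *\<^sub>R x + w *\<^sub>R (y + h) = x + h" "(1 - w) *\<^sub>R (y + h) + w *\<^sub>R x = y"
    using wh by (simp_all add: algebra_simps)
  ultimately show ?thesis by (simp add: algebra_simps)
qed (use assms in auto)

text \<open>By convexity between \<open>x i\<close> and \<open>x i + s\<close>, coordinate
  \<open>i\<close> gains at most the fraction \<open>t i\<close> of its full increment. That full
  increment is largest at the largest \<open>x j\<close>, and the fractions sum to
  \<open>1\<close>.\<close>

lemma convex_sum_le_point_transfer:
  fixes g :: "real \<Rightarrow> real" and x t :: "'i \<Rightarrow> real"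
  assumes g: "convex_on S g" and "finite I" "j \<in> I"
    and S: "\<And>i. i \<in> I \<Longrightarrow> x i \<in> S" "\<And>i. i \<in> I \<Longrightarrow> x i + s \<in> S"
    and max: "\<And>i. i \<in> I \<Longrightarrow> x i \<le> x j" and s: "s \<ge> 0"
    and t: "\<And>i. i \<in> I \<Longrightarrow> t i \<ge> 0" "sum t I = 1"
  shows "(\<Sum>i\<in>I. g (x i + s * t i)) \<le> (\<Sum>i\<in>I. g (x i + s * (if i = j then 1 else 0)))"
proof -
  have "g (x i + s * t i) \<le> g (x i) + t i * (g (x j + s) - g (x j))" if i: "i \<in> I" for i
  proof -
    have t1: "t i \<le> 1" using member_le_sum[of i I t] t assms(2) i by auto
    have "g ((1 - t i) *\<^sub>R x i + t i *\<^sub>R (x i + s)) \<le> (1 - t i) * g (x i) + t i * g (x i + s)"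
      using t1 t i S by (intro convex_onD[OF g]) auto
    also have "(1 - t i) *\<^sub>R x i + t i *\<^sub>R (x i + s) = x i + s * t i" by (simp add: algebra_simps)
    also have "(1 - t i) * g (x i) + t i * g (x i + s) = g (x i) + t i * (g (x i + s) - g (x i))"
      by (simp add: algebra_simps)
    also have "\<dots> \<le> g (x i) + t i * (g (x j + s) - g (x j))"
      using i assms t by (intro add_left_mono mult_left_mono convex_on_increments_mono[OF g]) auto
    finally show ?thesis .
  qed
  then have "(\<Sum>i\<in>I. g (x i + s * t i)) \<le> (\<Sum>i\<in>I. g (x i) + t i * (g (x j + s) - g (x j)))"
    by (rule sum_mono)
  also have "\<dots> = (\<Sum>i\<in>I. g (x i)) + (g (x j + s) - g (x j))"
    by (simp add: sum.distrib sum_distrib_right[symmetric] t)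
  also have "\<dots> = (\<Sum>i\<in>I. g (x i) + (if i = j then g (x j + s) - g (x j) else 0))"
    using assms(2,3) by (simp add: sum.distrib)
  also have "\<dots> = (\<Sum>i\<in>I. g (x i + s * (if i = j then 1 else 0)))"
    by (intro sum.cong) auto
  finally show ?thesis .
qed

text \<open>
  Where \<open>max (x i) c\<close> exceeds \<open>c\<close>, the tangent slope is at least \<open>g' c\<close> but \<open>y i\<close> can only lie
  above; elsewhere the slope is exactly \<open>g' c\<close>. So the tangents give \<open>g' c * (\<Sum>i. y i - max (x i) c) = 0\<close>.
\<close>

lemma convex_sum_ge_water_level:
  fixes g :: "real \<Rightarrow> real" and x y :: "'i \<Rightarrow> real"
  assumes g: "convex_on S g" "open S" "connected S"
    and g': "\<And>z. z \<in> S \<Longrightarrow> (g has_field_derivative g' z) (at z within S)"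
    and S: "c \<in> S" "\<And>i. i \<in> I \<Longrightarrow> x i \<in> S" "\<And>i. i \<in> I \<Longrightarrow> y i \<in> S"
    and ge: "\<And>i. i \<in> I \<Longrightarrow> x i \<le> y i" and eq: "(\<Sum>i\<in>I. y i) = (\<Sum>i\<in>I. max (x i) c)"
  shows "(\<Sum>i\<in>I. g (max (x i) c)) \<le> (\<Sum>i\<in>I. g (y i))"
proof -
  have tangent: "g' z * (w - z) \<le> g w - g z" if "z \<in> S" "w \<in> S" for z w
    using that g g' by (intro convex_on_imp_above_tangent[OF g(1,3)]) (auto simp: interior_open)
  have mono: "g' z \<le> g' w" if "z \<in> S" "w \<in> S" "z \<le> w" for z w
  proof (cases "z = w")
    case False
    \<comment> \<open>Sum of the tangent inequality at \<open>z\<close> evaluated in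
      \<open>w\<close> and the one at \<open>w\<close> evaluated in \<open>z\<close>.\<close>
    have "(g' w - g' z) * (w - z) \<ge> 0" using tangent[OF that(1,2)] tangent[OF that(2,1)]
      by (simp add: algebra_simps)
    then show ?thesis using False that by (simp add: zero_le_mult_iff)
  qed simp
  have "g' c * (y i - max (x i) c) \<le> g (y i) - g (max (x i) c)" if i: "i \<in> I" for i
  proof -
    have m: "max (x i) c \<in> S" using S i by (auto simp: max_def)
    have "g' c * (y i - max (x i) c) \<le> g' (max (x i) c) * (y i - max (x i) c)"
    proof (cases "x i \<le> c")
      case False
      then show ?thesis using ge[OF i] mono[OF S(1) S(2)[OF i]] by (intro mult_right_mono) auto
    qed (simp add: max_def)
    also have "\<dots> \<le> g (y i) - g (max (x i) c)" using tangent m S i by auto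
    finally show ?thesis .
  qed
  then have "(\<Sum>i\<in>I. g' c * (y i - max (x i) c)) \<le> (\<Sum>i\<in>I. g (y i) - g (max (x i) c))"
    by (rule sum_mono)
  then show ?thesis by (simp add: sum_distrib_left[symmetric] sum_subtractf eq)
qed

text \<open>
  All partial sums of \<open>c - x k\<close> are at most \<open>s\<close>, with equality for the minimiser. As \<open>x\<close> is
  sorted, the sum of the positive parts of \<open>c - x k\<close> is one of these partial sums.
\<close>

lemma water_level_fills:
  fixes x :: "nat \<Rightarrow> real"
  assumes d: "d \<ge> 1" and s: "s > 0" and mono: "mono_on {1..d} x"
  defines "c \<equiv> Min ((\<lambda>m. (s + (\<Sum>k=1..m. x k)) / real m) ` {1..d})"
  shows "(\<Sum>k=1..d. max (x k) c) = (\<Sum>k=1..d. x k) + s"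
proof -
  let ?q = "\<lambda>m. (s + (\<Sum>k=1..m. x k)) / real m"
  have "c \<in> ?q ` {1..d}" unfolding c_def using d by (intro Min_in) auto
  then obtain m where m: "m \<in> {1..d}" "c = ?q m" by auto
  have sum_le: "(\<Sum>k=1..l. c - x k) \<le> s" if "l \<in> {1..d}" for l
  proof -
    have "c \<le> ?q l" unfolding c_def using that by (intro Min_le) auto
    then have "real l * c \<le> s + (\<Sum>k=1..l. x k)" using that by (simp add: field_simps)
    then show ?thesis by (simp add: sum_subtractf)
  qed
  have "(\<Sum>k=1..d. max (c - x k) 0) = s"
  proof (rule antisym)
    have "real m * c = s + (\<Sum>k=1..m. x k)" using m by simp
    then have "s = (\<Sum>k=1..m. c - x k)" by (simp add: sum_subtractf)
    also have "\<dots> \<le> (\<Sum>k=1..m. max (c - x k) 0)" by (intro sum_mono) auto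
    also have "\<dots> \<le> (\<Sum>k=1..d. max (c - x k) 0)" using m by (intro sum_mono2) auto
    finally show "s \<le> (\<Sum>k=1..d. max (c - x k) 0)" .
    show "(\<Sum>k=1..d. max (c - x k) 0) \<le> s"
    proof (cases "\<exists>k\<in>{1..d}. x k < c")
      case True
      \<comment> \<open>Since \<open>x\<close> is sorted, the indices below the level
        \<open>c\<close> are exactly \<open>{1..l}\<close>, and the positive parts vanish beyond
        \<open>l\<close>.\<close>
      define l where "l = Max {k \<in> {1..d}. x k < c}"
      have "l \<in> {k \<in> {1..d}. x k < c}" unfolding l_def using True by (intro Max_in) auto
      then have l: "l \<in> {1..d}" "x l < c" by auto
      have below: "x k < c" if "k \<in> {1..l}" for k
        using mono_onD[OF mono, of k l] that l by force
      have above: "\<not> x k < c" if "k \<in> {1..d} - {1..l}" for k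
        using Max_ge[of "{k \<in> {1..d}. x k < c}" k] that by (force simp: l_def)
      have "max (c - x k) 0 = 0" if "k \<in> {1..d} - {1..l}" for k using above[OF that] by simp
      then have "(\<Sum>k=1..d. max (c - x k) 0) = (\<Sum>k=1..l. max (c - x k) 0)"
        using l by (intro sum.mono_neutral_right ballI) auto
      also have "\<dots> = (\<Sum>k=1..l. c - x k)" using below by (intro sum.cong) force+
      also have "\<dots> \<le> s" by (rule sum_le[OF l(1)])
      finally show ?thesis .
    next
      case False
      then have "(\<Sum>k=1..d. max (c - x k) 0) = 0" by (intro sum.neutral) force
      then show ?thesis using s by simp
    qed
  qed
  moreover have "max (x k) c = x k + max (c - x k) 0" for k by auto
  ultimately show ?thesis by (simp add: sum.distrib)
qed

text \<open>At positive integers the digamma function is a harmonic number minus the Euler constant.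
  The constant cancels in the difference, and the two harmonic numbers leave the sum from
  \<open>j + 1\<close> to \<open>N + S\<close>.\<close>

lemma entropy_term_integer:
  fixes S j :: int
  assumes u: "u \<in> {0..1}" and s: "s > 0" "s = of_int S" and j: "(real N + s) * u = of_int j"
  shows "entropy_term N s u = u * (\<Sum>k=j+1..int N + S. inverse (of_int k))"
proof -
  \<comment> \<open>As \<open>u\<close> lies in the unit interval, \<open>j\<close> lies between
    \<open>0\<close> and \<open>N + S\<close>, so both can be replaced by natural numbers
    \<open>b <= a\<close>.\<close>
  have "0 \<le> (real N + s) * u" "(real N + s) * u \<le> (real N + s) * 1"
    using u s by (intro mult_nonneg_nonneg mult_left_mono, auto)+
  then have "real_of_int 0 \<le> of_int j" "real_of_int j \<le> of_int (int N + S)"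
    unfolding j by (simp_all add: s(2)[symmetric])
  then have jb: "0 \<le> j" "j \<le> int N + S" by (simp_all only: of_int_le_iff)
  then obtain a b where ab: "j = int b" "int N + S = int a" "b \<le> a"
    by (metis nonneg_int_cases order_trans of_nat_le_iff)
  have A: "real N + s = real a" using ab(2) s by (metis of_int_add of_int_of_nat_eq)
  have "(\<Sum>k=j+1..int N + S. inverse (real_of_int k)) = (\<Sum>k\<in>int ` {Suc b..a}. inverse (real_of_int k))"
    unfolding ab(1,2) by (intro sum.cong) (auto simp: image_int_atLeastAtMost)
  also have "\<dots> = (\<Sum>k=Suc b..a. inverse (real k))" by (subst sum.reindex) auto
  also have "\<dots> = harm a - harm b"
  proof -
    have "{1..a} = {1..b} \<union> {Suc b..a}" using ab(3) by auto
    then have "(harm a :: real) = harm b + (\<Sum>k=Suc b..a. inverse (real k))"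
      unfolding harm_def by (simp add: sum.union_disjoint)
    then show ?thesis by simp
  qed
  finally have h: "(\<Sum>k=j+1..int N + S. inverse (real_of_int k)) = harm a - harm b" .
  have "Digamma (real k + 1) = harm k - euler_mascheroni" for k
    using Digamma_of_nat[of k, where 'a = real] by (simp add: add.commute)
  then show ?thesis
    unfolding entropy_term_def h j unfolding A ab(1) by simp
qed

section \<open>The imprecise Dirichlet model\<close>

locale idm =
  fixes d :: nat and n :: "nat \<Rightarrow> nat" and s :: real
  assumes d_ge_1: "d \<ge> 1" and s_pos: "s > 0"
begin

definition N :: real where "N = real (sample_size d n) + s"

lemma N_pos: "N > 0"
  using s_pos by (simp add: N_def)

lemma posterior_param_nonneg:
  assumes "t \<in> prob_simplex d" "i \<in> {1..d}"
  shows "posterior_param n s t i \<ge> 0"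
  using prob_simplexD[OF assms] s_pos by (simp add: posterior_param_def)

lemma sum_posterior_param:
  assumes "t \<in> prob_simplex d"
  shows "(\<Sum>i=1..d. posterior_param n s t i) = N"
  using assms
  by (simp add: posterior_param_def N_def sample_size_def sum.distrib sum_distrib_left[symmetric] prob_simplex_def)

lemma idm_u_eq: "idm_u d n s t i = posterior_param n s t i / N"
  by (simp add: idm_u_def posterior_param_def N_def)

lemma sum_idm_u: "t \<in> prob_simplex d \<Longrightarrow> (\<Sum>i=1..d. idm_u d n s t i) = 1"
  using N_pos sum_posterior_param[of t] by (simp add: idm_u_eq sum_divide_distrib[symmetric])

text \<open>Positive parameters give the finite Gamma quotient. Otherwise some parameter is
  \<open>0\<close>, while the sum of all of them is \<open>N > 0\<close>, and the mass is
  infinite.\<close>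

lemma idm_proper_iff:
  "t \<in> idm_proper d n s \<longleftrightarrow> t \<in> prob_simplex d \<and> (\<forall>i\<in>{1..d}. posterior_param n s t i > 0)"
proof (cases "t \<in> prob_simplex d")
  case True
  show ?thesis
  proof (cases "\<forall>i\<in>{1..d}. posterior_param n s t i > 0")
    case pos: True
    then have "dirichlet_mass d (posterior_param n s t) < \<infinity>"
      by (subst dirichlet_mass_eq) (use d_ge_1 in auto)
    then show ?thesis using pos True by (simp add: idm_proper_def dirichlet_proper_def)
  next
    case False
    then obtain k where "k \<in> {1..d}" "posterior_param n s t k = 0"
      using posterior_param_nonneg[OF True] by force
    then have "dirichlet_mass d (posterior_param n s t) = \<infinity>"
      by (intro dirichlet_mass_infinite[of _ _ k])
         (use posterior_param_nonneg[OF True] sum_posterior_param[OF True] N_pos in auto)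
    then show ?thesis using False by (auto simp: idm_proper_def dirichlet_proper_def)
  qed
qed (simp add: idm_proper_def)

lemma integral_idm_posterior_entropy:
  assumes "t \<in> idm_proper d n s"
  shows "(\<integral>p. vec_entropy d p \<partial>idm_posterior d n s t) =
    (\<Sum>i=1..d. entropy_term (sample_size d n) s (idm_u d n s t i))"
proof -
  interpret D: dirichlet_positive d "posterior_param n s t"
    using assms d_ge_1 by unfold_locales (auto simp: idm_proper_iff)
  have "D.total = N" using assms sum_posterior_param[of t] by (simp add: D.total_def idm_proper_iff)
  then show ?thesis
    unfolding idm_posterior_def D.integral_dirichlet_entropy
    using N_pos by (simp add: entropy_term_def idm_u_eq N_def[symmetric])
qed

section \<open>Continuous extension to the boundary\<close>

text \<open>The shift by \<open>1\<close> keeps the argument of \<open>Digamma\<close> away from its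
  poles even where a parameter vanishes.\<close>

lemma isCont_sum_entropy_term:
  assumes "t \<in> prob_simplex d"
  shows "isCont (\<lambda>t. \<Sum>i=1..d. entropy_term (sample_size d n) s (idm_u d n s t i)) t"
  unfolding entropy_term_def N_def[symmetric]
proof (intro continuous_sum continuous_mult continuous_diff continuous_const)
  fix i assume i: "i \<in> {1..d}"
  have "continuous_on UNIV (\<lambda>t::nat \<Rightarrow> real. t i)" by (rule continuous_on_product_coordinates)
  then have "isCont (\<lambda>t::nat \<Rightarrow> real. t i) t"
    unfolding continuous_on_eq_continuous_at[OF open_UNIV] by blast
  then show c: "isCont (\<lambda>t. idm_u d n s t i) t"
    unfolding idm_u_eq posterior_param_def using N_pos by (intro continuous_intros) auto
  have "N * idm_u d n s t i + 1 > 0"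
    using posterior_param_nonneg[OF assms i] N_pos by (simp add: idm_u_eq)
  then have "N * idm_u d n s t i + 1 \<notin> \<int>\<^sub>\<le>\<^sub>0" by (auto elim!: nonpos_Ints_cases)
  with c show "isCont (\<lambda>t. Digamma (N * idm_u d n s t i + 1)) t"
    by (intro isCont_Polygamma continuous_intros)
qed

text \<open>The value of \<open>Lim\<close> is determined only along a nontrivial filter. The
  segment from \<open>t\<close> towards the barycentre consists of proper points and maps
  \<open>at_right 0\<close> into the filter in question.\<close>

lemma at_within_idm_proper_nontrivial:
  assumes t: "t \<in> prob_simplex d" "t \<notin> idm_proper d n s"
  shows "at t within idm_proper d n s \<noteq> bot"
proof -
  define g where "g e = (\<lambda>i. if i \<in> {1..d} then (1 - e) * t i + e / d else undefined)" for e :: real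
  have g0: "g 0 = t" using t(1) by (auto simp: g_def prob_simplex_def PiE_def extensional_def)
  have g_proper: "g e \<in> idm_proper d n s" if e: "0 < e" "e < 1" for e
  proof -
    have pos: "g e i > 0" if "i \<in> {1..d}" for i
      using prob_simplexD[OF t(1) that] e d_ge_1 that by (auto simp: g_def intro!: add_nonneg_pos)
    have "(\<Sum>i=1..d. g e i) = (\<Sum>i=1..d. (1 - e) * t i + e / d)"
      by (intro sum.cong) (auto simp: g_def)
    also have "\<dots> = (1 - e) * (\<Sum>i=1..d. t i) + e"
      using d_ge_1 by (simp add: sum.distrib sum_distrib_left)
    also have "\<dots> = 1" using t(1) by (simp add: prob_simplex_def)
    finally have "g e \<in> prob_simplex d"
      using less_imp_le[OF pos] by (auto simp: prob_simplex_def PiE_def extensional_def g_def)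
    then show ?thesis
      using pos s_pos by (auto simp: idm_proper_iff posterior_param_def intro!: add_nonneg_pos)
  qed
  have "continuous_on UNIV g"
  proof (rule continuous_on_coordinatewise_then_product)
    fix i
    show "continuous_on UNIV (\<lambda>e. g e i)"
      unfolding g_def by (cases "i \<in> {1..d}") (auto intro!: continuous_intros)
  qed
  then have "isCont g 0" by (simp add: continuous_on_eq_continuous_at)
  then have "(g \<longlongrightarrow> t) (at_right 0)"
    using g0 by (auto simp: isCont_def intro: filterlim_mono[OF _ order_refl at_le])
  \<comment> \<open>The filter excludes \<open>t\<close> itself; \<open>g e\<close> differs from
    \<open>t\<close> because \<open>g e\<close> is proper and \<open>t\<close> is not.\<close>
  moreover have "\<forall>\<^sub>F e in at_right 0. g e \<in> idm_proper d n s \<and> g e \<noteq> t"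
    using g_proper t(2) by (auto intro!: eventually_at_rightI[of 0 1])
  ultimately have "filterlim g (at t within idm_proper d n s) (at_right 0)"
    by (simp add: filterlim_at)
  then have lim: "filtermap g (at_right 0) \<le> at t within idm_proper d n s" by (simp add: filterlim_def)
  show ?thesis
  proof
    assume "at t within idm_proper d n s = bot"
    with lim have "filtermap g (at_right 0) = bot" using bot_unique by metis
    then show False by (simp add: filtermap_bot_iff)
  qed
qed

text \<open>At an improper \<open>t\<close> the integrals at nearby proper points agree with the
  continuous formula, so their limit is the value of the formula at \<open>t\<close>.\<close>

lemma expected_entropy_eq:
  assumes t: "t \<in> prob_simplex d"
  shows "expected_entropy d n s t = (\<Sum>i=1..d. entropy_term (sample_size d n) s (idm_u d n s t i))"
proof (cases "t \<in> idm_proper d n s")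
  case True
  then show ?thesis by (simp add: idm_expectation_def integral_idm_posterior_entropy)
next
  case False
  let ?H = "\<lambda>t. \<Sum>i=1..d. entropy_term (sample_size d n) s (idm_u d n s t i)"
  have "(?H \<longlongrightarrow> ?H t) (at t within idm_proper d n s)"
    using isCont_sum_entropy_term[OF t] by (auto simp: isCont_def intro: filterlim_mono[OF _ order_refl at_le])
  moreover have "\<forall>\<^sub>F t' in at t within idm_proper d n s.
      ?H t' = (\<integral>p. vec_entropy d p \<partial>idm_posterior d n s t')"
    by (auto simp: eventually_at_filter integral_idm_posterior_entropy)
  ultimately have "((\<lambda>t'. \<integral>p. vec_entropy d p \<partial>idm_posterior d n s t') \<longlongrightarrow> ?H t)
      (at t within idm_proper d n s)"
    by (rule Lim_transform_eventually)
  then show ?thesis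
    using False at_within_idm_proper_nontrivial[OF t False] by (simp add: idm_expectation_def tendsto_Lim)
qed

section \<open>Extremal hyperparameters\<close>

text \<open>As the \<open>u i\<close> sum to \<open>1\<close>, the first digamma term is the same
  for all \<open>t\<close>. Minimising the entropy thus means maximising a sum of values of the
  convex function \<open>x * Digamma (x + 1)\<close>, and conversely.\<close>

lemma expected_entropy_eq_param:
  assumes t: "t \<in> prob_simplex d"
  shows "expected_entropy d n s t = Digamma (N + 1) -
    (\<Sum>i=1..d. posterior_param n s t i * Digamma (posterior_param n s t i + 1)) / N"
proof -
  have "entropy_term (sample_size d n) s (idm_u d n s t i) = idm_u d n s t i * Digamma (N + 1) -
      posterior_param n s t i * Digamma (posterior_param n s t i + 1) / N" for i
  proof -
    have "N * idm_u d n s t i = posterior_param n s t i" using N_pos by (simp add: idm_u_eq)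
    then have "entropy_term (sample_size d n) s (idm_u d n s t i) =
        idm_u d n s t i * (Digamma (N + 1) - Digamma (posterior_param n s t i + 1))"
      by (simp only: entropy_term_def N_def[symmetric])
    then show ?thesis by (simp add: idm_u_eq right_diff_distrib)
  qed
  then have "expected_entropy d n s t = (\<Sum>i=1..d. idm_u d n s t i) * Digamma (N + 1) -
    (\<Sum>i=1..d. posterior_param n s t i * Digamma (posterior_param n s t i + 1)) / N"
    unfolding expected_entropy_eq[OF t]
    by (simp add: sum_subtractf sum_distrib_right sum_divide_distrib)
  then show ?thesis unfolding sum_idm_u[OF t] by simp
qed

lemma lower_expected_entropy:
  assumes j: "is_arg_max n (\<lambda>i. i \<in> {1..d}) j"
  shows "\<exists>t. (\<forall>i\<in>{1..d}. idm_u d n s t i = u_lower d n s j i) \<and>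
    is_arg_min (expected_entropy d n s) (\<lambda>t. t \<in> prob_simplex d) t"
proof (intro exI conjI)
  \<comment> \<open>The vertex of the simplex at \<open>j\<close>, restricted because points of
    \<open>prob_simplex d\<close> are extensional.\<close>
  let ?t = "restrict (\<lambda>i. if i = j then 1 else 0 :: real) {1..d}"
  have jd: "j \<in> {1..d}" and max: "\<And>i. i \<in> {1..d} \<Longrightarrow> n i \<le> n j"
    using j by (auto simp: is_arg_max_def not_less)
  show "\<forall>i\<in>{1..d}. idm_u d n s ?t i = u_lower d n s j i"
    by (auto simp: idm_u_def u_lower_def)
  have t: "?t \<in> prob_simplex d"
    using jd by (auto simp: prob_simplex_def)
  have "expected_entropy d n s ?t \<le> expected_entropy d n s t" if t': "t \<in> prob_simplex d" for t
  proof -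
    have "(\<Sum>i=1..d. posterior_param n s t i * Digamma (posterior_param n s t i + 1)) \<le>
        (\<Sum>i=1..d. (real (n i) + s * (if i = j then 1 else 0)) *
            Digamma (real (n i) + s * (if i = j then 1 else 0) + 1))"
      unfolding posterior_param_def
      by (rule convex_sum_le_point_transfer[OF convex_on_mult_Digamma])
         (use t' jd max s_pos in \<open>auto simp: prob_simplex_def PiE_def Pi_def intro: less_le_trans[of "-1" 0]\<close>)
    also have "\<dots> = (\<Sum>i=1..d. posterior_param n s ?t i * Digamma (posterior_param n s ?t i + 1))"
      by (intro sum.cong) (auto simp: posterior_param_def)
    finally show ?thesis
      unfolding expected_entropy_eq_param[OF t] expected_entropy_eq_param[OF t']
      using N_pos by (simp add: divide_right_mono)
  qed
  then show "is_arg_min (expected_entropy d n s) (\<lambda>t. t \<in> prob_simplex d) ?t"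
    using t by (auto simp: is_arg_min_def not_less)
qed

lemma upper_expected_entropy:
  assumes \<sigma>: "bij_betw \<sigma> {1..d} {1..d}" "mono_on {1..d} (\<lambda>k. n (\<sigma> k))"
  shows "\<exists>t. (\<forall>i\<in>{1..d}. idm_u d n s t i = u_upper d n s \<sigma> i) \<and>
    is_arg_max (expected_entropy d n s) (\<lambda>t. t \<in> prob_simplex d) t"
proof (intro exI conjI)
  \<comment> \<open>The water level on the scale of the counts; dividing by \<open>N\<close> gives
    \<open>u_tilde\<close>, since division by a positive number commutes with
    \<open>Min\<close>.\<close>
  define c where "c = Min ((\<lambda>m. (s + (\<Sum>k=1..m. real (n (\<sigma> k)))) / real m) ` {1..d})"
  have c_tilde: "u_tilde d n s \<sigma> = c / N"
  proof -
    have "c / N = Min ((\<lambda>x. x / N) ` (\<lambda>m. (s + (\<Sum>k=1..m. real (n (\<sigma> k)))) / real m) ` {1..d})"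
      unfolding c_def using d_ge_1 N_pos
      by (intro mono_Min_commute) (auto simp: mono_def divide_right_mono)
    then show ?thesis by (simp add: u_tilde_def image_image N_def)
  qed
  \<comment> \<open>The solution of \<open>n i + s * t i = max (n i) c\<close>, which raises every
    count below the level to \<open>c\<close>.\<close>
  let ?t = "restrict (\<lambda>i. (max (real (n i)) c - real (n i)) / s) {1..d}"
  have param: "posterior_param n s ?t i = max (real (n i)) c" if "i \<in> {1..d}" for i
    using that s_pos by (simp add: posterior_param_def)
  show "\<forall>i\<in>{1..d}. idm_u d n s ?t i = u_upper d n s \<sigma> i"
  proof
    fix i assume "i \<in> {1..d}"
    then have "idm_u d n s ?t i = max (real (n i)) c / N" by (simp only: idm_u_eq param)
    then show "idm_u d n s ?t i = u_upper d n s \<sigma> i"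
      using N_pos by (simp add: u_upper_def c_tilde N_def[symmetric] max_divide_distrib_right)
  qed
  \<comment> \<open>The filling identity holds for the sorted counts; reindexing by the bijection
    \<open>\<sigma>\<close> transfers it to the original order and shows that \<open>?t\<close> sums
    to \<open>1\<close>.\<close>
  have "(\<Sum>k=1..d. max (real (n (\<sigma> k))) c) = (\<Sum>k=1..d. real (n (\<sigma> k))) + s"
    unfolding c_def using \<sigma>(2) by (intro water_level_fills d_ge_1 s_pos) (auto simp: mono_on_def)
  then have fill: "(\<Sum>i=1..d. max (real (n i)) c) = (\<Sum>i=1..d. real (n i)) + s"
    by (simp only: sum.reindex_bij_betw[OF \<sigma>(1), of "\<lambda>i. max (real (n i)) c"]
        sum.reindex_bij_betw[OF \<sigma>(1), of "\<lambda>i. real (n i)"])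
  then have "(\<Sum>i=1..d. ?t i) = 1"
    using s_pos by (simp add: sum_divide_distrib[symmetric] sum_subtractf)
  then have t: "?t \<in> prob_simplex d"
    using s_pos by (auto simp: prob_simplex_def)
  \<comment> \<open>This places the level inside the domain of convexity
    \<open>{-1<..}\<close>.\<close>
  have c_nonneg: "c \<ge> 0"
    unfolding c_def using d_ge_1 s_pos
    by (subst Min_ge_iff) (auto intro!: divide_nonneg_nonneg add_nonneg_nonneg sum_nonneg)
  have "expected_entropy d n s t \<le> expected_entropy d n s ?t" if t': "t \<in> prob_simplex d" for t
  proof -
    have "(\<Sum>i=1..d. posterior_param n s ?t i * Digamma (posterior_param n s ?t i + 1)) =
        (\<Sum>i=1..d. max (real (n i)) c * Digamma (max (real (n i)) c + 1))"
      by (intro sum.cong refl) (simp only: param)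
    also have "\<dots> \<le> (\<Sum>i=1..d. posterior_param n s t i * Digamma (posterior_param n s t i + 1))"
    proof (rule convex_sum_ge_water_level[OF convex_on_mult_Digamma])
      show "(\<Sum>i=1..d. posterior_param n s t i) = (\<Sum>i=1..d. max (real (n i)) c)"
        unfolding fill sum_posterior_param[OF t'] by (simp add: N_def sample_size_def)
      show "((\<lambda>x. x * Digamma (x + 1)) has_field_derivative
          Digamma (z + 1) + z * Polygamma 1 (z + 1)) (at z within {-1<..})" if "z \<in> {-1<..}" for z :: real
        using that by (intro has_field_derivative_mult_Digamma) auto
      fix i assume i: "i \<in> {1..d}"
      show "posterior_param n s t i \<in> {-1<..}" using posterior_param_nonneg[OF t' i] by simp
      show "real (n i) \<le> posterior_param n s t i"
        using prob_simplexD[OF t' i] s_pos by (simp add: posterior_param_def)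
    qed (use c_nonneg in \<open>auto intro: less_le_trans[of "-1" 0]\<close>)
    finally show ?thesis
      unfolding expected_entropy_eq_param[OF t] expected_entropy_eq_param[OF t']
      using N_pos by (simp add: divide_right_mono)
  qed
  then show "is_arg_max (expected_entropy d n s) (\<lambda>t. t \<in> prob_simplex d) ?t"
    using t by (auto simp: is_arg_max_def not_less)
qed

end

theorem theorem2:
  fixes d :: nat and n :: "nat \<Rightarrow> nat" and s :: real
  assumes "d \<ge> 1" and "s > 0"
  shows "(\<forall>t\<in>prob_simplex d.
            expected_entropy d n s t = (\<Sum>i=1..d. entropy_term (sample_size d n) s (idm_u d n s t i)))
    \<and> (\<forall>u\<in>{0..1}. \<forall>S j :: int.
            s = of_int S \<longrightarrow> (real (sample_size d n) + s) * u = of_int j \<longrightarrow>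
            entropy_term (sample_size d n) s u = u * (\<Sum>k=j+1..int (sample_size d n) + S. inverse (of_int k)))
    \<and> (\<forall>j. is_arg_max n (\<lambda>i. i \<in> {1..d}) j \<longrightarrow>
            (\<exists>t. (\<forall>i\<in>{1..d}. idm_u d n s t i = u_lower d n s j i) \<and>
                 is_arg_min (expected_entropy d n s) (\<lambda>t. t \<in> prob_simplex d) t))
    \<and> (\<forall>\<sigma>. bij_betw \<sigma> {1..d} {1..d} \<and> mono_on {1..d} (\<lambda>k. n (\<sigma> k)) \<longrightarrow>
            (\<exists>t. (\<forall>i\<in>{1..d}. idm_u d n s t i = u_upper d n s \<sigma> i) \<and>
                 is_arg_max (expected_entropy d n s) (\<lambda>t. t \<in> prob_simplex d) t))"
proof -
  interpret idm d n s using assms by unfold_locales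
  show ?thesis
  proof (intro conjI ballI allI impI)
    fix t assume "t \<in> prob_simplex d"
    then show "expected_entropy d n s t = (\<Sum>i=1..d. entropy_term (sample_size d n) s (idm_u d n s t i))"
      by (rule expected_entropy_eq)
  next
    fix u :: real and S j :: int
    assume "u \<in> {0..1}" "s = of_int S" "(real (sample_size d n) + s) * u = of_int j"
    then show "entropy_term (sample_size d n) s u = u * (\<Sum>k=j+1..int (sample_size d n) + S. inverse (of_int k))"
      using assms(2) by (intro entropy_term_integer)
  next
    fix j assume "is_arg_max n (\<lambda>i. i \<in> {1..d}) j"
    then show "\<exists>t. (\<forall>i\<in>{1..d}. idm_u d n s t i = u_lower d n s j i) \<and>
        is_arg_min (expected_entropy d n s) (\<lambda>t. t \<in> prob_simplex d) t"
      by (rule lower_expected_entropy)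
  next
    fix \<sigma> assume "bij_betw \<sigma> {1..d} {1..d} \<and> mono_on {1..d} (\<lambda>k. n (\<sigma> k))"
    then show "\<exists>t. (\<forall>i\<in>{1..d}. idm_u d n s t i = u_upper d n s \<sigma> i) \<and>
        is_arg_max (expected_entropy d n s) (\<lambda>t. t \<in> prob_simplex d) t"
      by (intro upper_expected_entropy) auto
  qed
qed

end
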